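(* Let $X\in S_n$ be a $k$-decomposable access sequence. Then the cost of \textsc{Greedy} on $X$ with a linear-cost preprocessing (in the geometric view: \textsc{Greedy} run without initial tree) is at most $n\,2^{O(k^2)}$, i.e. $|\textsc{Greedy}(X)|\le n\,2^{ck^2}$ for an absolute constant $c$.
   Context: Blocks and decomposability: for $\sigma\in S_\ell$, an interval $[a,b]\subseteq[\ell]$ is a block if $\{\sigma_a,\dots,\sigma_b\}$ is a set of consecutive integers. A permutation of length 1 is $k$-decomposable; $\sigma$ of length $\ell\ge 2$ is $k$-decomposable if $[\ell]$ can be partitioned into $m$ consecutive intervals, $2\le m\le k$, each a block, such that the permutation order-isomorphic to each restriction is $k$-decomposable. Geometric model: $X=(x_1,\dots,x_n)$ is the set of access points $\{(x_t,t)\}$ (key, time). $\square_{pq}$ is the closed axis-parallel rectangle with corners $p,q$. \textsc{Greedy} without initial tree: let $\tau(b,t)$ be the largest time $\le t$ at which column $b$ contains an output point (undefined if none). At time $t$ with access $(a,t)$, add $(a,t)$ and $(b,t)$ for each $b\ne a$ with $\tau(b,t-1)$ defined such that $\square_{(a,t),(b,\tau(b,t-1))}$ contains no output point at times $<t$ other than $(b,\tau(b,t-1))$. $\textsc{Greedy}(X)$ is the output set, and its size is the cost. The preprocessing (putting keys in a split tree before the first access) corresponds exactly to running \textsc{Greedy} in this geometric view with no initial-tree points. *)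

theory Defs
  imports Complex_Main "HOL-Combinatorics.Permutations"
begin

text \<open>A permutation \<open>\<sigma> \<in> S\<^sub>l\<close> is a function with \<open>\<sigma> permutes {1..l}\<close>;
  \<open>\<sigma> i\<close> is its \<open>i\<close>-th entry.\<close>

definition is_block :: "nat \<Rightarrow> (nat \<Rightarrow> nat) \<Rightarrow> nat \<Rightarrow> nat \<Rightarrow> bool" where
  "is_block l \<sigma> a b \<longleftrightarrow> 1 \<le> a \<and> a \<le> b \<and> b \<le> l \<and> (\<exists>u v. \<sigma> ` {a..b} = {u..v})"

text \<open>The permutation of \<open>{1..b - a + 1}\<close> that is order-isomorphic to
  \<open>\<sigma> a, \<dots>, \<sigma> b\<close>: each value is replaced by its rank among them.\<close>

definition pattern :: "(nat \<Rightarrow> nat) \<Rightarrow> nat \<Rightarrow> nat \<Rightarrow> nat \<Rightarrow> nat" where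
  "pattern \<sigma> a b i =
     (if i \<in> {1..b - a + 1} then card {j \<in> {a..b}. \<sigma> j \<le> \<sigma> (a + i - 1)} else i)"

text \<open>A partition of \<open>{1..l}\<close> into \<open>m\<close> consecutive intervals is given by cut points
  \<open>0 = c 0 < c 1 < \<dots> < c m = l\<close>; the intervals are \<open>{c i + 1..c (i + 1)}\<close> for \<open>i < m\<close>.\<close>

inductive decomposable :: "nat \<Rightarrow> nat \<Rightarrow> (nat \<Rightarrow> nat) \<Rightarrow> bool" for k :: nat where
  single: "\<sigma> permutes {1..1} \<Longrightarrow> decomposable k 1 \<sigma>"
| split: "\<sigma> permutes {1..l} \<Longrightarrow> 2 \<le> l \<Longrightarrow> 2 \<le> m \<Longrightarrow> m \<le> k \<Longrightarrow>
    c 0 = 0 \<Longrightarrow> c m = l \<Longrightarrow> \<forall>i<m. c i < c (Suc i) \<Longrightarrow>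
    \<forall>i<m. is_block l \<sigma> (c i + 1) (c (Suc i)) \<Longrightarrow>
    \<forall>i<m. decomposable k (c (Suc i) - c i) (pattern \<sigma> (c i + 1) (c (Suc i))) \<Longrightarrow>
    decomposable k l \<sigma>"

text \<open>Points of the plane are pairs (key, time).\<close>

definition rect :: "nat \<times> nat \<Rightarrow> nat \<times> nat \<Rightarrow> (nat \<times> nat) set" where
  "rect p q = {min (fst p) (fst q)..max (fst p) (fst q)} \<times> {min (snd p) (snd q)..max (snd p) (snd q)}"

definition touched :: "(nat \<times> nat) set \<Rightarrow> nat \<Rightarrow> nat \<Rightarrow> bool" where
  "touched P b t \<longleftrightarrow> (\<exists>s\<le>t. (b, s) \<in> P)"

text \<open>\<open>\<tau>(b, t)\<close> with respect to the point set \<open>P\<close>; only meaningful if \<open>touched P b t\<close>.\<close>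

definition last_touch :: "(nat \<times> nat) set \<Rightarrow> nat \<Rightarrow> nat \<Rightarrow> nat" where
  "last_touch P b t = Max {s. s \<le> t \<and> (b, s) \<in> P}"

text \<open>\<open>greedy_upto X t\<close> is the set of output points at times \<open>1..t\<close>. Times start at 1 and
  there are no points at time 0, i.e. no initial tree.\<close>

fun greedy_upto :: "(nat \<Rightarrow> nat) \<Rightarrow> nat \<Rightarrow> (nat \<times> nat) set" where
  "greedy_upto X 0 = {}"
| "greedy_upto X (Suc t) =
     (let P = greedy_upto X t; a = X (Suc t) in
       P \<union> {(a, Suc t)} \<union>
       {(b, Suc t) | b. b \<noteq> a \<and> touched P b t \<and>
          rect (a, Suc t) (b, last_touch P b t) \<inter> P \<subseteq> {(b, last_touch P b t)}})"

definition greedy :: "nat \<Rightarrow> (nat \<Rightarrow> nat) \<Rightarrow> (nat \<times> nat) set" where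
  "greedy n X = greedy_upto X n"

lemma pattern_order_iso:
  assumes "\<sigma> permutes {1..l}" "1 \<le> a" "a \<le> b" "b \<le> l"
    and "i \<in> {1..b - a + 1}" "j \<in> {1..b - a + 1}"
  shows "pattern \<sigma> a b i < pattern \<sigma> a b j \<longleftrightarrow> \<sigma> (a + i - 1) < \<sigma> (a + j - 1)"
proof -
  let ?R = "\<lambda>i. {r \<in> {a..b}. \<sigma> r \<le> \<sigma> (a + i - 1)}"
  have lt: "card (?R i) < card (?R j)"
    if "\<sigma> (a + i - 1) < \<sigma> (a + j - 1)" "j \<in> {1..b - a + 1}" for i j
  proof (rule psubset_card_mono)
    have "a + j - 1 \<in> ?R j" "a + j - 1 \<notin> ?R i" using that assms(2,3) by auto
    moreover have "?R i \<subseteq> ?R j" using that by auto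
    ultimately show "?R i \<subset> ?R j" by blast
  qed simp
  have "card (?R i) < card (?R j) \<longleftrightarrow> \<sigma> (a + i - 1) < \<sigma> (a + j - 1)"
  proof (cases "\<sigma> (a + i - 1)" "\<sigma> (a + j - 1)" rule: linorder_cases)
    case less
    then show ?thesis using lt assms(6) by blast
  next
    case equal
    then show ?thesis by simp
  next
    case greater
    then have "card (?R j) < card (?R i)" using lt assms(5) by blast
    then show ?thesis using greater by simp
  qed
  then show ?thesis using assms(5,6) by (simp add: pattern_def)
qed

lemma pattern_permutes:
  assumes "\<sigma> permutes {1..l}" "1 \<le> a" "a \<le> b" "b \<le> l"
  shows "pattern \<sigma> a b permutes {1..b - a + 1}"
proof (rule bij_imp_permutes)
  let ?I = "{1..b - a + 1}"
  have inj: "inj_on (pattern \<sigma> a b) ?I"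
  proof (rule inj_onI)
    fix i j assume ij: "i \<in> ?I" "j \<in> ?I" "pattern \<sigma> a b i = pattern \<sigma> a b j"
    then have "\<sigma> (a + i - 1) = \<sigma> (a + j - 1)"
      using pattern_order_iso[OF assms ij(1,2)] pattern_order_iso[OF assms ij(2,1)] by simp
    then have "a + i - 1 = a + j - 1" using permutes_inj[OF assms(1)] by (auto dest: injD)
    then show "i = j" using ij by auto
  qed
  have "pattern \<sigma> a b ` ?I \<subseteq> ?I"
  proof
    fix y assume "y \<in> pattern \<sigma> a b ` ?I"
    then obtain i where i: "i \<in> ?I" "y = card {j \<in> {a..b}. \<sigma> j \<le> \<sigma> (a + i - 1)}"
      by (auto simp: pattern_def)
    have "y \<le> card {a..b}" unfolding i(2) by (rule card_mono) auto
    moreover have "a + i - 1 \<in> {j \<in> {a..b}. \<sigma> j \<le> \<sigma> (a + i - 1)}" using i(1) assms by auto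
    then have "y > 0" unfolding i(2) by (subst card_gt_0_iff) auto
    ultimately show "y \<in> ?I" using assms by auto
  qed
  then show "bij_betw (pattern \<sigma> a b) ?I ?I"
    using inj by (simp add: bij_betw_def endo_inj_surj)
qed (auto simp: pattern_def)

lemma decomposable_permutes: "decomposable k l \<sigma> \<Longrightarrow> \<sigma> permutes {1..l}"
  by (induction rule: decomposable.induct) auto

lemma greedy_subset:
  assumes "X permutes {1..n}"
  shows "greedy n X \<subseteq> {1..n} \<times> {1..n}"
proof -
  have "greedy_upto X t \<subseteq> {1..n} \<times> {1..t}" if "t \<le> n" for t
    using that
  proof (induction t)
    case (Suc t)
    then have "X (Suc t) \<in> {1..n}" using permutes_in_image[OF assms, of "Suc t"] by simp
    with Suc show ?case by (fastforce simp: Let_def touched_def)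
  qed simp
  then show ?thesis by (simp add: greedy_def)
qed

lemma finite_greedy: "X permutes {1..n} \<Longrightarrow> finite (greedy n X)"
  using finite_subset[OF greedy_subset] by simp

end

theory Submission
  imports Defs
begin

text \<open>
  Greedy in fact touches only \<open>O(n k)\<close> points. Consider a block of the decomposition, with its
  interval of times and its interval of keys. Its keys are untouched before its first row, so the
  first row touches, on either side, the keys whose stamps are visible from the block. Afterwards
  the nearest touched key on each side hides all keys behind it, so every later row of the block
  touches at most two keys outside the block.

  Every row but the first is the first row of a child \<open>C\<close>, not the oldest one, of a unique block
  \<open>B\<close>. It touches one key of \<open>C\<close>, at most two keys outside \<open>B\<close>, and some keys of the older
  siblings of \<open>C\<close>. The latter are paid for by a potential: the number of keys of a sibling whose
  stamps are strict right-to-left or left-to-right maxima. The touched keys of a sibling are such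
  maxima on the side facing \<open>C\<close>; once they carry equal stamps, all but one of them stop being
  maxima on that side, while on the other side at most one new maximum arises. Hence each sibling
  pays for its touched keys up to \<open>O(1)\<close>, there are fewer than \<open>k\<close> siblings, and the potential of
  a block is at most the sum over its children, so everything telescopes along the decomposition.
\<close>

section \<open>Greedy in terms of stamps\<close>

text \<open>With \<open>f\<close> the stamps (times of last touch, \<open>0\<close> for never), this is the row that Greedy
  adds on access \<open>a\<close>. If \<open>f a = 0\<close>, untouched keys other than \<open>a\<close> are excluded automatically.\<close>

definition visible :: "(nat \<Rightarrow> nat) \<Rightarrow> nat \<Rightarrow> nat set" where
  "visible f a = {b. \<forall>y\<in>{min a b..max a b} - {b}. f y < f b}"

fun stamp :: "(nat \<Rightarrow> nat) \<Rightarrow> nat \<Rightarrow> nat \<Rightarrow> nat" where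
  "stamp X 0 = (\<lambda>_. 0)"
| "stamp X (Suc t) = (\<lambda>b. if b \<in> visible (stamp X t) (X (Suc t)) then Suc t else stamp X t b)"

definition row_cost :: "(nat \<Rightarrow> nat) \<Rightarrow> nat \<Rightarrow> nat" where
  "row_cost X t = card (visible (stamp X t) (X (Suc t)))"

lemma self_visible [simp]: "a \<in> visible f a"
  by (auto simp: visible_def)

lemma visible_pos: "b \<in> visible f a \<Longrightarrow> b \<noteq> a \<Longrightarrow> 0 < f b"
  unfolding visible_def by (cases "a < b") (auto dest: bspec[where x = a])

lemma stamp_le: "stamp X t b \<le> t"
  by (induction t) (auto simp: le_SucI)

lemma stamp_mono: "s \<le> t \<Longrightarrow> stamp X s b \<le> stamp X t b"
  by (induction rule: dec_induct) (auto intro: order_trans[OF stamp_le])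

text \<open>Besides its access a row touches only keys with a positive stamp, so being touched
  amounts to having been accessed.\<close>

lemma stamp_pos_iff: "0 < stamp X t b \<longleftrightarrow> b \<in> X ` {0<..t}"
proof (induction t)
  case (Suc t)
  have "{0<..Suc t} = insert (Suc t) {0<..t}" by auto
  then show ?case using Suc visible_pos[of b "stamp X t" "X (Suc t)"] by auto
qed simp

lemma finite_visible_stamp: "finite (visible (stamp X t) a)"
proof (rule finite_subset)
  show "visible (stamp X t) a \<subseteq> insert a (X ` {0<..t})"
    using visible_pos[of _ "stamp X t" a] by (auto simp: stamp_pos_iff)
qed simp

text \<open>A stamp is the topmost point of its column, so a column meets the rectangle exactly if
  its stamp reaches the height \<open>f b\<close>. The row formula and the invariant depend on each
  other: \<open>row\<close> takes the invariant at \<open>t\<close> as a premise, and the induction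
  supplies it.\<close>

lemma greedy_upto_stamp:
  "(\<forall>b s. (b, s) \<in> greedy_upto X t \<longrightarrow> 0 < s \<and> s \<le> stamp X t b) \<and>
   (\<forall>b. 0 < stamp X t b \<longrightarrow> (b, stamp X t b) \<in> greedy_upto X t)"
  "greedy_upto X (Suc t) =
    greedy_upto X t \<union> (\<lambda>b. (b, Suc t)) ` visible (stamp X t) (X (Suc t))"
proof -
  have row: "greedy_upto X (Suc t) =
      greedy_upto X t \<union> (\<lambda>b. (b, Suc t)) ` visible (stamp X t) (X (Suc t))"
    if I: "\<And>b s. (b, s) \<in> greedy_upto X t \<Longrightarrow> 0 < s \<and> s \<le> stamp X t b"
      "\<And>b. 0 < stamp X t b \<Longrightarrow> (b, stamp X t b) \<in> greedy_upto X t" for t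
  proof -
    let ?P = "greedy_upto X t" and ?f = "stamp X t" and ?a = "X (Suc t)"
    have touched: "touched ?P b t \<longleftrightarrow> 0 < ?f b" for b
      unfolding touched_def using I stamp_le[of X t b] by fastforce
    have last: "last_touch ?P b t = ?f b" if "0 < ?f b" for b
      unfolding last_touch_def
    proof (rule Max_eqI)
      show "finite {s. s \<le> t \<and> (b, s) \<in> ?P}" by simp
      show "?f b \<in> {s. s \<le> t \<and> (b, s) \<in> ?P}" using I that stamp_le[of X t b] by simp
    qed (use I in auto)
    have "touched ?P b t \<and> rect (?a, Suc t) (b, last_touch ?P b t) \<inter> ?P \<subseteq> {(b, last_touch ?P b t)}
        \<longleftrightarrow> b \<in> visible ?f ?a" (is "?l \<longleftrightarrow> ?r") if ba: "b \<noteq> ?a" for b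
    proof
      assume ?l
      then have pos: "0 < ?f b" and R: "rect (?a, Suc t) (b, ?f b) \<inter> ?P \<subseteq> {(b, ?f b)}"
        using touched last by auto
      show ?r unfolding visible_def
      proof (intro CollectI ballI)
        fix y assume y: "y \<in> {min ?a b..max ?a b} - {b}"
        show "?f y < ?f b"
        proof (rule ccontr)
          assume "\<not> ?f y < ?f b"
          then have "(y, ?f y) \<in> rect (?a, Suc t) (b, ?f b) \<inter> ?P"
            using y pos I(2)[of y] stamp_le[of X t y] stamp_le[of X t b] by (auto simp: rect_def)
          then show False using R y by auto
        qed
      qed
    next
      assume r: ?r
      then have pos: "0 < ?f b" using visible_pos ba by blast
      have "rect (?a, Suc t) (b, ?f b) \<inter> ?P \<subseteq> {(b, ?f b)}"
      proof
        fix q assume q: "q \<in> rect (?a, Suc t) (b, ?f b) \<inter> ?P"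
        obtain y s where ys: "q = (y, s)" by (cases q)
        have s: "?f b \<le> s" "y \<in> {min ?a b..max ?a b}" "s \<le> ?f y"
          using q ys I(1)[of y s] stamp_le[of X t b] by (auto simp: rect_def)
        have "y = b"
        proof (rule ccontr)
          assume "y \<noteq> b"
          then have "?f y < ?f b" using r s(2) unfolding visible_def by blast
          then show False using s by simp
        qed
        then show "q \<in> {(b, ?f b)}" using s ys by simp
      qed
      then show ?l using pos touched last by simp
    qed
    then have "insert (?a, Suc t) {(b, Suc t) |b. b \<noteq> ?a \<and> touched ?P b t \<and>
        rect (?a, Suc t) (b, last_touch ?P b t) \<inter> ?P \<subseteq> {(b, last_touch ?P b t)}}
        = (\<lambda>b. (b, Suc t)) ` visible ?f ?a"
      using self_visible[of ?a ?f] by blast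
    then show ?thesis by (simp only: greedy_upto.simps Let_def Un_assoc insert_is_Un[symmetric])
  qed
  show inv: "(\<forall>b s. (b, s) \<in> greedy_upto X t \<longrightarrow> 0 < s \<and> s \<le> stamp X t b) \<and>
   (\<forall>b. 0 < stamp X t b \<longrightarrow> (b, stamp X t b) \<in> greedy_upto X t)"
  proof (induction t)
    case (Suc t)
    have eq: "greedy_upto X (Suc t) =
      greedy_upto X t \<union> (\<lambda>b. (b, Suc t)) ` visible (stamp X t) (X (Suc t))"
      by (rule row) (use Suc in auto)
    have le: "stamp X t b \<le> stamp X (Suc t) b" for b by (rule stamp_mono) simp
    have "0 < s \<and> s \<le> stamp X (Suc t) b" if "(b, s) \<in> greedy_upto X (Suc t)" for b s
      using that Suc le[of b] unfolding eq by (auto simp del: greedy_upto.simps split: if_splits intro: order_trans)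
    moreover have "(b, stamp X (Suc t) b) \<in> greedy_upto X (Suc t)" if "0 < stamp X (Suc t) b" for b
      using that Suc unfolding eq by (auto simp del: greedy_upto.simps split: if_splits)
    ultimately show ?case by blast
  qed simp
  show "greedy_upto X (Suc t) =
    greedy_upto X t \<union> (\<lambda>b. (b, Suc t)) ` visible (stamp X t) (X (Suc t))"
    by (rule row) (use inv in auto)
qed

lemma card_greedy_upto_le: "card (greedy_upto X t) \<le> (\<Sum>s<t. row_cost X s)"
proof (induction t)
  case (Suc t)
  have "card ((\<lambda>b. (b, Suc t)) ` visible (stamp X t) (X (Suc t))) = row_cost X t"
    unfolding row_cost_def by (rule card_image) (auto simp: inj_on_def)
  then have "card (greedy_upto X (Suc t)) \<le> card (greedy_upto X t) + row_cost X t"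
    unfolding greedy_upto_stamp(2) by (metis card_Un_le)
  then show ?case using Suc by simp
qed simp

section \<open>Keys outside a block during its rows\<close>

text \<open>Seen from the key interval \<open>{u..v}\<close>, the key \<open>z\<close> lies in front of \<open>y\<close>.\<close>

definition shields :: "nat \<Rightarrow> nat \<Rightarrow> nat \<Rightarrow> nat \<Rightarrow> bool" where
  "shields u v z y \<longleftrightarrow> y < z \<and> z < u \<or> v < z \<and> z < y"

lemma stamp_outside_block:
  assumes "s \<le> t" "t \<le> e" "y \<notin> X ` {s<..e}"
  shows "0 < stamp X t y \<longleftrightarrow> 0 < stamp X s y"
proof -
  have "{0<..t} = {0<..s} \<union> {s<..t}" "{s<..t} \<subseteq> {s<..e}" using assms by auto
  then show ?thesis using assms(3) by (auto simp: stamp_pos_iff)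
qed

text \<open>Injectivity allows only one access per key, and for a key of the block it is still to
  come.\<close>

lemma stamp_in_block:
  assumes "inj X" "y \<in> X ` {s<..e}"
  shows "stamp X s y = 0"
proof -
  obtain r where "y = X r" "s < r" using assms(2) by auto
  then have "y \<notin> X ` {0<..s}" using inj_image_mem_iff[OF assms(1), of r "{0<..s}"] by simp
  then show ?thesis using stamp_pos_iff by blast
qed

text \<open>The nearest touched key \<open>w\<close> on the side of \<open>y\<close> is touched in
  row \<open>Suc s\<close>. From then on it lies between every access of the block and
  \<open>y\<close>, which can never overtake it.\<close>

lemma shielded_not_visible:
  assumes inj: "inj X" and I: "X ` {s<..e} = {u..v}"
    and z: "shields u v z y" "0 < stamp X s z" and t: "s < t" "t < e"
  shows "y \<notin> visible (stamp X t) (X (Suc t))"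
proof -
  let ?Q = "\<lambda>z. shields u v z y \<and> 0 < stamp X s z"
  \<comment> \<open>Outside \<open>{u..v}\<close> exactly one of the truncated differences is
    nonzero, so their sum is the distance to that interval.\<close>
  obtain w where w: "?Q w" and min: "\<And>x. ?Q x \<Longrightarrow> (w - v) + (u - w) \<le> (x - v) + (u - x)"
    using ex_has_least_nat[of ?Q z "\<lambda>x. (x - v) + (u - x)"] z by auto
  have acc: "X r \<in> {u..v}" if "s < r" "r \<le> e" for r using I that by auto
  have uv: "u \<le> v" using acc[of "Suc s"] t by simp
  have nearest: "stamp X s x = 0" if "shields u v x w" for x
  proof (rule ccontr)
    assume "stamp X s x \<noteq> 0"
    then have "?Q x" using that w uv by (auto simp: shields_def)
    then show False using min[of x] that uv by (auto simp: shields_def)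
  qed
  have zero: "stamp X s x = 0" if "x \<in> {u..v}" for x
    using stamp_in_block[OF inj] that I by blast
  have first: "w \<in> visible (stamp X s) (X (Suc s))"
    unfolding visible_def
  proof (intro CollectI ballI)
    fix x assume "x \<in> {min (X (Suc s)) w..max (X (Suc s)) w} - {w}"
    then have "x \<in> {u..v} \<or> shields u v x w"
      using acc[of "Suc s"] t w by (auto simp: shields_def)
    then show "stamp X s x < stamp X s w" using zero nearest w by auto
  qed
  have w': "Suc s \<le> stamp X r w" if "s < r" for r
    using stamp_mono[of "Suc s" r X w] that first by simp
  have hidden: "y \<notin> visible (stamp X r) (X (Suc r))"
    if "s < r" "r < e" "stamp X r y \<le> Suc s" for r
  proof
    assume "y \<in> visible (stamp X r) (X (Suc r))"
    moreover have "w \<in> {min (X (Suc r)) y..max (X (Suc r)) y} - {y}"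
      using acc[of "Suc r"] that w by (auto simp: shields_def)
    ultimately have "stamp X r w < stamp X r y" unfolding visible_def by blast
    then show False using w'[OF that(1)] that(3) by simp
  qed
  \<comment> \<open>Row \<open>Suc s\<close> may touch \<open>y\<close> too, giving a tie with
    \<open>w\<close>; a tie still hides \<open>y\<close>, since \<open>visible\<close> asks for a
    strict inequality.\<close>
  have "Suc s \<le> r \<Longrightarrow> r < e \<longrightarrow> stamp X r y \<le> Suc s" for r
  proof (induction rule: dec_induct)
    case base
    then show ?case using stamp_le by blast
  next
    case (step r)
    then show ?case using hidden[of r] by auto
  qed
  then show ?thesis using hidden t by simp
qed

lemma visible_outside_block:
  assumes "X ` {s<..e} = {u..v}" "s \<le> t" "t < e"
    and "y \<in> visible (stamp X t) (X (Suc t))" "y \<notin> {u..v}"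
  shows "0 < stamp X s y"
proof -
  have "X (Suc t) \<in> {u..v}" using assms(1,2,3) by auto
  then have "0 < stamp X t y" using visible_pos assms(4,5) by metis
  then show ?thesis using stamp_outside_block[of s t e y X] assms by auto
qed

text \<open>Of two distinct keys the one nearer to the block would shield the other. The rows may
  differ because \<open>potential_over_block\<close> needs one key per side for all later rows
  together.\<close>

lemma visible_outside_block_unique:
  assumes "inj X" "X ` {s<..e} = {u..v}" "s < t" "t < e" "s < t'" "t' < e"
    and "y \<in> visible (stamp X t) (X (Suc t))" "y' \<in> visible (stamp X t') (X (Suc t'))"
    and "y < u \<and> y' < u \<or> v < y \<and> v < y'"
  shows "y = y'"
proof (rule ccontr)
  assume "y \<noteq> y'"
  then have "shields u v y y' \<or> shields u v y' y" using assms(9) by (auto simp: shields_def)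
  moreover have "0 < stamp X s y" "0 < stamp X s y'"
    using visible_outside_block[OF assms(2) _ assms(4,7)]
      visible_outside_block[OF assms(2) _ assms(6,8)] assms(3,5,9) by auto
  ultimately show False using shielded_not_visible[OF assms(1,2)] assms by blast
qed

lemma card_visible_outside_block:
  assumes "inj X" "X ` {s<..e} = {u..v}" "s < t" "t < e"
  shows "card (visible (stamp X t) (X (Suc t)) - {u..v}) \<le> 2"
proof -
  let ?V = "visible (stamp X t) (X (Suc t))"
  note unique = visible_outside_block_unique[OF assms(1-4) assms(3,4)]
  have fin: "finite ?V" by (rule finite_visible_stamp)
  have "card (?V \<inter> {..<u}) \<le> 1" "card (?V \<inter> {v<..}) \<le> 1"
    using fin unique by (auto simp: card_le_Suc0_iff_eq)
  moreover have "?V - {u..v} \<subseteq> (?V \<inter> {..<u}) \<union> (?V \<inter> {v<..})" by auto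
  then have "card (?V - {u..v}) \<le> card ((?V \<inter> {..<u}) \<union> (?V \<inter> {v<..}))"
    using fin by (intro card_mono) auto
  ultimately show ?thesis using card_Un_le[of "?V \<inter> {..<u}" "?V \<inter> {v<..}"] by linarith
qed

section \<open>Strict maxima of the stamps as a potential\<close>

text \<open>These are the keys of \<open>I\<close> that an access to the right of \<open>I\<close>
  sees if no key outside \<open>I\<close> interferes; \<open>lmax\<close> is the mirror
  image.\<close>

definition rmax :: "(nat \<Rightarrow> nat) \<Rightarrow> nat set \<Rightarrow> nat set" where
  "rmax f I = {x \<in> I. \<forall>y\<in>I. x < y \<longrightarrow> f y < f x}"

definition lmax :: "(nat \<Rightarrow> nat) \<Rightarrow> nat set \<Rightarrow> nat set" where
  "lmax f I = {x \<in> I. \<forall>y\<in>I. y < x \<longrightarrow> f y < f x}"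

definition potential :: "(nat \<Rightarrow> nat) \<Rightarrow> nat set \<Rightarrow> nat" where
  "potential f I = card (rmax f I) + card (lmax f I)"

lemma finite_rmax [simp]: "finite I \<Longrightarrow> finite (rmax f I)"
  and finite_lmax [simp]: "finite I \<Longrightarrow> finite (lmax f I)"
  by (simp_all add: rmax_def lmax_def)

text \<open>A strict maximum of the union remains one in every part that contains it.\<close>

lemma potential_UN_le:
  assumes "finite N" "\<And>i. i \<in> N \<Longrightarrow> finite (A i)"
  shows "potential f (\<Union>i\<in>N. A i) \<le> (\<Sum>i\<in>N. potential f (A i))"
proof -
  have "card (rmax f (\<Union>i\<in>N. A i)) \<le> card (\<Union>i\<in>N. rmax f (A i))"
    using assms by (intro card_mono) (auto simp: rmax_def)
  moreover have "card (lmax f (\<Union>i\<in>N. A i)) \<le> card (\<Union>i\<in>N. lmax f (A i))"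
    using assms by (intro card_mono) (auto simp: lmax_def)
  ultimately show ?thesis
    using card_UN_le[OF assms(1), of "\<lambda>i. rmax f (A i)"] card_UN_le[OF assms(1), of "\<lambda>i. lmax f (A i)"]
    by (simp add: potential_def sum.distrib)
qed

text \<open>The keys of \<open>W\<close> end up tied, so at most \<open>Max W\<close> survives in
  \<open>rmax\<close> and \<open>Min W\<close> in \<open>lmax\<close>; these two account for the 2.
  No other key becomes a maximum, as values only rise elsewhere, and one of the two sets loses all
  of \<open>W\<close>.\<close>

lemma potential_touch:
  assumes fin: "finite I" and W: "W \<subseteq> rmax f I \<or> W \<subseteq> lmax f I"
    and g: "\<And>x. x \<in> I \<Longrightarrow> g x = (if x \<in> W then T else f x)" and T: "\<And>x. x \<in> I \<Longrightarrow> f x < T"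
  shows "potential g I + card W \<le> potential f I + 2"
proof (cases "W = {}")
  case True
  then have "rmax g I = rmax f I" "lmax g I = lmax f I" using g by (auto simp: rmax_def lmax_def)
  then show ?thesis using True by (simp add: potential_def)
next
  case False
  have WI: "W \<subseteq> I" using W by (auto simp: rmax_def lmax_def)
  then have finW: "finite W" using fin finite_subset by blast
  have le: "f x \<le> g x" if "x \<in> I" for x using g T that by (simp add: less_imp_le)
  have r: "rmax g I \<subseteq> insert (Max W) (rmax f I - W)"
  proof
    fix x assume x: "x \<in> rmax g I"
    show "x \<in> insert (Max W) (rmax f I - W)"
    proof (cases "x \<in> W")
      case True
      have "y \<le> x" if "y \<in> W" for y
      proof (rule ccontr)
        assume "\<not> y \<le> x"
        then have "g y < g x" using x that WI by (auto simp: rmax_def)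
        then show False using g[of x] g[of y] that True subsetD[OF WI] by simp
      qed
      then have "Max W = x" using True finW by (intro Max_eqI)
      then show ?thesis by simp
    next
      case False
      then have "g x = f x" using g x by (simp add: rmax_def)
      then show ?thesis using x le False by (fastforce simp: rmax_def)
    qed
  qed
  have l: "lmax g I \<subseteq> insert (Min W) (lmax f I - W)"
  proof
    fix x assume x: "x \<in> lmax g I"
    show "x \<in> insert (Min W) (lmax f I - W)"
    proof (cases "x \<in> W")
      case True
      have "x \<le> y" if "y \<in> W" for y
      proof (rule ccontr)
        assume "\<not> x \<le> y"
        then have "g y < g x" using x that WI by (auto simp: lmax_def)
        then show False using g[of x] g[of y] that True subsetD[OF WI] by simp
      qed
      then have "Min W = x" using True finW by (intro Min_eqI)
      then show ?thesis by simp
    next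
      case False
      then have "g x = f x" using g x by (simp add: lmax_def)
      then show ?thesis using x le False by (fastforce simp: lmax_def)
    qed
  qed
  have r': "card (rmax g I) \<le> Suc (card (rmax f I - W))"
    using card_mono[OF _ r] fin card_insert_le_m1[of "Suc (card (rmax f I - W))" "rmax f I - W" "Max W"] by simp
  have l': "card (lmax g I) \<le> Suc (card (lmax f I - W))"
    using card_mono[OF _ l] fin card_insert_le_m1[of "Suc (card (lmax f I - W))" "lmax f I - W" "Min W"] by simp
  have "card (rmax f I - W) + card (lmax f I - W) + card W \<le> card (rmax f I) + card (lmax f I)"
    using W
  proof
    assume "W \<subseteq> rmax f I"
    then have "card (rmax f I - W) + card W = card (rmax f I)"
      using fin finW by (simp add: card_Diff_subset card_mono)
    moreover have "card (lmax f I - W) \<le> card (lmax f I)" using fin by (intro card_mono) auto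
    ultimately show ?thesis by simp
  next
    assume "W \<subseteq> lmax f I"
    then have "card (lmax f I - W) + card W = card (lmax f I)"
      using fin finW by (simp add: card_Diff_subset card_mono)
    moreover have "card (rmax f I - W) \<le> card (rmax f I)" using fin by (intro card_mono) auto
    ultimately show ?thesis by simp
  qed
  then show ?thesis using r' l' by (simp add: potential_def)
qed

text \<open>Raising one value can create a new maximum only at \<open>y\<close>, once in each
  direction.\<close>

lemma potential_change_one:
  assumes fin: "finite I" and g: "\<And>x. x \<in> I \<Longrightarrow> x \<noteq> y \<Longrightarrow> g x = f x" and le: "f y \<le> g y"
  shows "potential g I \<le> potential f I + 2"
proof -
  have "f x \<le> g x" if "x \<in> I" for x using g le that by (cases "x = y") auto
  then have "rmax g I \<subseteq> insert y (rmax f I)" "lmax g I \<subseteq> insert y (lmax f I)"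
    using g by (fastforce simp: rmax_def lmax_def)+
  then have "card (rmax g I) \<le> card (insert y (rmax f I))" "card (lmax g I) \<le> card (insert y (lmax f I))"
    using fin by (auto intro!: card_mono)
  moreover have "card (insert y (rmax f I)) \<le> Suc (card (rmax f I))"
    "card (insert y (lmax f I)) \<le> Suc (card (lmax f I))"
    using fin by (simp_all add: card_insert_if)
  ultimately show ?thesis by (simp add: potential_def)
qed

lemma stamp_changed:
  assumes "s \<le> e" "stamp X e x \<noteq> stamp X s x"
  shows "\<exists>t. s \<le> t \<and> t < e \<and> x \<in> visible (stamp X t) (X (Suc t))"
  using assms
proof (induction rule: dec_induct)
  case (step t)
  then show ?case by (cases "x \<in> visible (stamp X t) (X (Suc t))") (auto intro: less_SucI)
qed simp

text \<open>The interval lies on one side of the block, so the first row touches only maxima facing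
  the block. The 4 is 2 for this row and 2 for the single key that later rows may touch.\<close>

lemma potential_over_block:
  assumes inj: "inj X" and I: "X ` {s<..e} = {u..v}" and se: "s < e"
    and disj: "v' < u \<or> v < u'"
  shows "potential (stamp X e) {u'..v'} + card (visible (stamp X s) (X (Suc s)) \<inter> {u'..v'})
    \<le> potential (stamp X s) {u'..v'} + 4"
proof -
  let ?V = "visible (stamp X s) (X (Suc s))"
  have a: "X (Suc s) \<in> {u..v}" using I se by auto
  have "?V \<inter> {u'..v'} \<subseteq> rmax (stamp X s) {u'..v'} \<or> ?V \<inter> {u'..v'} \<subseteq> lmax (stamp X s) {u'..v'}"
    using disj
  proof
    assume "v' < u"
    then have "?V \<inter> {u'..v'} \<subseteq> rmax (stamp X s) {u'..v'}"
      using a by (auto simp: rmax_def visible_def)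
    then show ?thesis ..
  next
    assume "v < u'"
    then have "?V \<inter> {u'..v'} \<subseteq> lmax (stamp X s) {u'..v'}"
      using a by (auto simp: lmax_def visible_def)
    then show ?thesis ..
  qed
  then have 1: "potential (stamp X (Suc s)) {u'..v'} + card (?V \<inter> {u'..v'})
      \<le> potential (stamp X s) {u'..v'} + 2"
    by (rule potential_touch[rotated, where T = "Suc s"]) (auto simp: stamp_le le_imp_less_Suc)
  \<comment> \<open>Later rows touch at most one key on this side, perhaps repeatedly. If no stamp
    changes, any \<open>y\<close> will do.\<close>
  obtain y where y: "\<And>x. x \<in> {u'..v'} \<Longrightarrow> x \<noteq> y \<Longrightarrow> stamp X e x = stamp X (Suc s) x"
  proof (cases "\<exists>y\<in>{u'..v'}. stamp X e y \<noteq> stamp X (Suc s) y")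
    case True
    then obtain y where y: "y \<in> {u'..v'}" "stamp X e y \<noteq> stamp X (Suc s) y" by blast
    have changed: "\<exists>t. s < t \<and> t < e \<and> x \<in> visible (stamp X t) (X (Suc t))"
      if "stamp X e x \<noteq> stamp X (Suc s) x" for x
      using stamp_changed[OF _ that] se by (auto simp: Suc_le_eq)
    show ?thesis
    proof (rule that, rule ccontr)
      fix x assume x: "x \<in> {u'..v'}" "x \<noteq> y" "stamp X e x \<noteq> stamp X (Suc s) x"
      obtain t t' where "s < t" "t < e" "x \<in> visible (stamp X t) (X (Suc t))"
        "s < t'" "t' < e" "y \<in> visible (stamp X t') (X (Suc t'))"
        using changed x(3) y(2) by meson
      moreover have "x < u \<and> y < u \<or> v < x \<and> v < y" using disj x y by auto
      ultimately show False using visible_outside_block_unique[OF inj I] x(2) by blast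
    qed
  qed blast
  have "potential (stamp X e) {u'..v'} \<le> potential (stamp X (Suc s)) {u'..v'} + 2"
    using y by (rule potential_change_one[rotated]) (use se in \<open>auto simp: stamp_mono simp del: stamp.simps\<close>)
  then show ?thesis using 1 by simp
qed

section \<open>Summing row costs over the children of a block\<close>

text \<open>The first row of the block, at time \<open>s + 1\<close>, is left out: it is charged to an ancestor.
  Row \<open>t + 1\<close> has cost \<open>row_cost X t\<close>.\<close>

definition block_cost :: "(nat \<Rightarrow> nat) \<Rightarrow> nat \<Rightarrow> nat \<Rightarrow> nat" where
  "block_cost X s e = (\<Sum>t\<in>{s<..<e}. row_cost X t)"

lemma block_cost_split:
  assumes "s < r" "r < e"
  shows "block_cost X s e = block_cost X s r + row_cost X r + block_cost X r e"
proof -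
  have "{s<..<e} = {s<..<r} \<union> insert r {r<..<e}" using assms by auto
  then show ?thesis unfolding block_cost_def by (simp add: sum.union_disjoint)
qed

lemma strict_mono_upto:
  fixes P :: "nat \<Rightarrow> nat"
  assumes "\<And>i. i < m \<Longrightarrow> P i < P (Suc i)" "i < j" "j \<le> m"
  shows "P i < P j"
proof -
  have "Suc i \<le> j" using assms(2) by simp
  then have "j \<le> m \<longrightarrow> P i < P j"
  proof (induction rule: dec_induct)
    case (step j)
    then show ?case using assms(1)[of j] by (auto intro: less_trans)
  qed (use assms(1) in simp)
  then show ?thesis using assms(3) by blast
qed

lemma UN_consecutive:
  fixes P :: "nat \<Rightarrow> nat"
  assumes "\<And>i. i < j \<Longrightarrow> P i < P (Suc i)"
  shows "P 0 \<le> P j \<and> (\<Union>i<j. {P i<..P (Suc i)}) = {P 0<..P j}"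
  using assms
proof (induction j)
  case (Suc j)
  then have IH: "P 0 \<le> P j" "(\<Union>i<j. {P i<..P (Suc i)}) = {P 0<..P j}" by simp_all
  have "P j < P (Suc j)" using Suc.prems by simp
  then show ?case using IH by (auto simp: lessThan_Suc)
qed simp

text \<open>The 3 counts the access and at most two keys outside the parent, the latter because
  \<open>0 < j\<close> makes this a later row of the parent. Any other touched key was accessed
  earlier within the parent, hence by an older sibling.\<close>

lemma row_cost_first_of_child:
  assumes inj: "inj X" and P: "\<And>i. i < m \<Longrightarrow> P i < P (Suc i)"
    and I: "X ` {P 0<..P m} = {u..v}" and j: "0 < j" "j < m"
  shows "row_cost X (P j) \<le>
    3 + (\<Sum>i<j. card (visible (stamp X (P j)) (X (Suc (P j))) \<inter> X ` {P i<..P (Suc i)}))"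
proof -
  let ?a = "X (Suc (P j))" and ?V = "visible (stamp X (P j)) (X (Suc (P j)))"
  let ?U = "\<Union>i<j. ?V \<inter> X ` {P i<..P (Suc i)}"
  have fin: "finite ?V" by (rule finite_visible_stamp)
  have Uj: "(\<Union>i<j. {P i<..P (Suc i)}) = {P 0<..P j}" using UN_consecutive[of j P] P j by simp
  have Pj: "P 0 < P j" "P j < P m" using strict_mono_upto[of m P] P j by auto
  have "?V \<subseteq> (?V - {u..v}) \<union> insert ?a ?U"
  proof
    fix x assume x: "x \<in> ?V"
    show "x \<in> (?V - {u..v}) \<union> insert ?a ?U"
    proof (cases "x \<in> {u..v} \<and> x \<noteq> ?a")
      case True
      then obtain r where r: "x = X r" "r \<in> {P 0<..P m}" using I by (metis imageE)
      have "x \<in> X ` {0<..P j}" using visible_pos x True stamp_pos_iff by blast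
      then have "r \<in> {P 0<..P j}" using r inj_image_mem_iff[OF inj, of r "{0<..P j}"] by simp
      then have "x \<in> X ` (\<Union>i<j. {P i<..P (Suc i)})" using r Uj by simp
      then show ?thesis using x by blast
    qed (use x in auto)
  qed
  then have "card ?V \<le> card ((?V - {u..v}) \<union> insert ?a ?U)"
    using fin by (intro card_mono) auto
  also have "\<dots> \<le> card (?V - {u..v}) + card (insert ?a ?U)" by (rule card_Un_le)
  also have "card (insert ?a ?U) \<le> Suc (card ?U)" using fin by (simp add: card_insert_if)
  also have "card ?U \<le> (\<Sum>i<j. card (?V \<inter> X ` {P i<..P (Suc i)}))" by (rule card_UN_le) simp
  also have "card (?V - {u..v}) \<le> 2" by (rule card_visible_outside_block[OF inj I Pj])
  finally show ?thesis by (simp add: row_cost_def)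
qed

text \<open>The summand \<open>4 * k\<close> is a credit. Appending child \<open>r\<close> joins two
  bounds that each carry it, which frees one: it pays 4 for each of the \<open>r\<close> older
  siblings and 3 for the first row of the child.\<close>

lemma block_cost_of_children:
  assumes inj: "inj X" and m: "0 < m" "m \<le> k" and P: "\<And>i. i < m \<Longrightarrow> P i < P (Suc i)"
    and I: "X ` {P 0<..P m} = {u..v}"
    and child: "\<And>i. i < m \<Longrightarrow> \<exists>u v. X ` {P i<..P (Suc i)} = {u..v}"
    and cost: "\<And>i. i < m \<Longrightarrow>
      block_cost X (P i) (P (Suc i)) + potential (stamp X (P (Suc i))) (X ` {P i<..P (Suc i)}) + 4 * k
        \<le> (2 + 4 * k) * (P (Suc i) - P i)"
  shows "block_cost X (P 0) (P m) + potential (stamp X (P m)) {u..v} + 4 * k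
    \<le> (2 + 4 * k) * (P m - P 0)"
proof -
  let ?A = "\<lambda>i. X ` {P i<..P (Suc i)}"
  \<comment> \<open>The potentials are kept apart per child: older siblings may lie on both sides of
    the next child, so their union need not have a single facing side.\<close>
  have "Suc j \<le> m \<Longrightarrow> block_cost X (P 0) (P (Suc j)) + (\<Sum>i<Suc j. potential (stamp X (P (Suc j))) (?A i)) + 4 * k
    \<le> (2 + 4 * k) * (P (Suc j) - P 0)" for j
  proof (induction j)
    case 0
    then show ?case using cost[of 0] by simp
  next
    case (Suc j)
    define r where "r = Suc j"
    have r: "0 < r" "r < m" using Suc.prems by (simp_all add: r_def)
    let ?V = "visible (stamp X (P r)) (X (Suc (P r)))"
    obtain ur vr where Ar: "?A r = {ur..vr}" using child r by blast
    have Pr: "P r < P (Suc r)" using P r by blast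
    have Pr0: "P 0 < P r" using strict_mono_upto[of m P] P r by auto
    have IH: "block_cost X (P 0) (P r) + (\<Sum>i<r. potential (stamp X (P r)) (?A i)) + 4 * k
      \<le> (2 + 4 * k) * (P r - P 0)" using Suc unfolding r_def by simp
    have step: "potential (stamp X (P (Suc r))) (?A i) + card (?V \<inter> ?A i)
        \<le> potential (stamp X (P r)) (?A i) + 4" if i: "i < r" for i
    proof -
      obtain u' v' where Ai: "?A i = {u'..v'}" using child i r by (meson less_trans)
      have Pi: "P i < P (Suc i)" using P i r by simp
      have "P (Suc i) \<le> P r" using strict_mono_upto[of m P "Suc i" r] P i r by (cases "Suc i = r") auto
      then have "{P i<..P (Suc i)} \<inter> {P r<..P (Suc r)} = {}" by auto
      then have "?A i \<inter> ?A r = {}" using inj by (metis image_Int image_empty)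
      \<comment> \<open>Disjoint nonempty intervals are separated, so the sibling lies wholly on one
        side of the child.\<close>
      moreover have "u' \<le> v'" "ur \<le> vr"
        using Ai Ar Pi Pr by (metis atLeastatMost_empty_iff image_is_empty greaterThanAtMost_empty_iff not_le)+
      ultimately have "v' < ur \<or> vr < u'" unfolding Ai Ar
        by (metis IntI atLeastAtMost_iff empty_iff le_cases not_le)
      then show ?thesis unfolding Ai using potential_over_block[OF inj Ar Pr] by blast
    qed
    have "(\<Sum>i<r. potential (stamp X (P (Suc r))) (?A i)) + (\<Sum>i<r. card (?V \<inter> ?A i))
        \<le> (\<Sum>i<r. potential (stamp X (P r)) (?A i)) + 4 * r"
      using sum_mono[of "{..<r}", OF step] by (simp add: sum.distrib mult.commute)
    moreover have "row_cost X (P r) \<le> 3 + (\<Sum>i<r. card (?V \<inter> ?A i))"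
      by (rule row_cost_first_of_child[OF inj P I r])
    moreover have "4 * r + 3 \<le> 4 * k" using r m by simp
    moreover have "(2 + 4 * k) * (P (Suc r) - P 0)
        = (2 + 4 * k) * (P r - P 0) + (2 + 4 * k) * (P (Suc r) - P r)"
    proof -
      have "P (Suc r) - P 0 = (P r - P 0) + (P (Suc r) - P r)" using Pr Pr0 by simp
      then show ?thesis by (simp only: distrib_left)
    qed
    ultimately show ?case
      using IH cost[OF r(2)] block_cost_split[OF Pr0 Pr, of X]
      unfolding r_def[symmetric] sum.lessThan_Suc by linarith
  qed
  from this[of "m - 1"] have main: "block_cost X (P 0) (P m) + (\<Sum>i<m. potential (stamp X (P m)) (?A i)) + 4 * k
    \<le> (2 + 4 * k) * (P m - P 0)" using m by simp
  have "{u..v} = (\<Union>i<m. ?A i)" using UN_consecutive[of m P] P I by (metis image_UN)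
  then have "potential (stamp X (P m)) {u..v} \<le> (\<Sum>i<m. potential (stamp X (P m)) (?A i))"
    using potential_UN_le[of "{..<m}" ?A "stamp X (P m)"] by simp
  then show ?thesis using main by simp
qed

section \<open>Induction along the decomposition\<close>

text \<open>Block values are consecutive, so ranks are values shifted by \<open>u - 1\<close>; the 1
  is moved to the left to avoid truncated subtraction.\<close>

lemma pattern_block:
  assumes inj: "inj \<sigma>" and im: "\<sigma> ` {a..b} = {u..v}" and i: "i \<in> {1..b - a + 1}" "a \<le> b" "1 \<le> a"
  shows "\<sigma> (a + i - 1) + 1 = u + pattern \<sigma> a b i"
proof -
  let ?x = "\<sigma> (a + i - 1)"
  have x: "?x \<in> {u..v}" unfolding im[symmetric] using i by (intro imageI) auto
  have "\<sigma> ` {j \<in> {a..b}. \<sigma> j \<le> ?x} = {u..v} \<inter> {..?x}" unfolding im[symmetric] by auto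
  also have "\<dots> = {u..?x}" using x by auto
  finally have "card {j \<in> {a..b}. \<sigma> j \<le> ?x} = card {u..?x}"
    using card_image[OF inj_on_subset[OF inj subset_UNIV]] by metis
  then show ?thesis using x i by (simp add: pattern_def)
qed

text \<open>Nested patterns occur in \<open>X\<close> as translates, hence the offsets
  \<open>p\<close> in time and \<open>q\<close> in key. The stamps are always those of the whole run
  on \<open>X\<close>.\<close>

lemma decomposable_block_cost:
  assumes "decomposable k l \<sigma>" "inj X" "\<And>i. i \<in> {1..l} \<Longrightarrow> X (p + i) = q + \<sigma> i"
  shows "block_cost X p (p + l) + potential (stamp X (p + l)) (X ` {p<..p + l}) + 4 * k
    \<le> (2 + 4 * k) * l"
  using assms(1,3)
proof (induction arbitrary: p q rule: decomposable.induct)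
  case (single \<sigma>)
  \<comment> \<open>No row is counted and the potential is 2, one per direction: this is the 2 in
    \<open>2 + 4 * k\<close>.\<close>
  have "{p<..p + 1} = {Suc p}" "{p<..<p + 1} = {}" by auto
  moreover have "rmax f {x} = {x}" "lmax f {x} = {x}" for f and x :: nat
    by (auto simp: rmax_def lmax_def)
  ultimately show ?case by (simp add: block_cost_def potential_def del: stamp.simps)
next
  case (split \<sigma> l m c)
  have inj\<sigma>: "inj \<sigma>" using split.hyps(1) permutes_inj by blast
  have shift: "{p + x<..p + y} = (+) p ` {x + 1..y}" for x y by (auto simp: image_add_atLeastAtMost)
  have im: "X ` {p + x<..p + y} = (+) q ` \<sigma> ` {x + 1..y}" if "y \<le> l" for x y
    unfolding shift image_image by (rule image_cong) (use split.prems that in auto)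
  have child: "\<exists>u v. u \<le> v \<and> 1 \<le> u \<and> c i < c (Suc i) \<and> c (Suc i) \<le> l \<and> \<sigma> ` {c i + 1..c (Suc i)} = {u..v}" if i: "i < m" for i
  proof -
    have b: "c i + 1 \<le> c (Suc i)" "c (Suc i) \<le> l" 
      using split.hyps(8) i unfolding is_block_def by blast+
    obtain u v where uv: "\<sigma> ` {c i + 1..c (Suc i)} = {u..v}"
      using split.hyps(8) i unfolding is_block_def by blast
    have "\<sigma> (c i + 1) \<in> {u..v}" unfolding uv[symmetric] using b by auto
    then have "u \<le> v" by simp
    then have "u \<in> \<sigma> ` {c i + 1..c (Suc i)}" using uv by simp
    then have "1 \<le> u" using permutes_in_image[OF split.hyps(1)] b by fastforce
    then show ?thesis using b uv \<open>u \<le> v\<close> by auto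
  qed
  have whole: "X ` {p + c 0<..p + c m} = {q + 1..q + l}"
    using im[of l 0] permutes_image[OF split.hyps(1)] split.hyps by (simp add: image_add_atLeastAtMost)
  have "block_cost X (p + c 0) (p + c m) + potential (stamp X (p + c m)) {q + 1..q + l} + 4 * k
    \<le> (2 + 4 * k) * (p + c m - (p + c 0))"
  proof (rule block_cost_of_children[where P = "\<lambda>i. p + c i", OF assms(2)])
    show "X ` {p + c 0<..p + c m} = {q + 1..q + l}" by (rule whole)
    fix i assume i: "i < m"
    obtain u v where uv: "u \<le> v" "1 \<le> u" "c i < c (Suc i)" "c (Suc i) \<le> l" "\<sigma> ` {c i + 1..c (Suc i)} = {u..v}"
      using child[OF i] by blast
    show "p + c i < p + c (Suc i)" using uv by simp
    show "\<exists>u v. X ` {p + c i<..p + c (Suc i)} = {u..v}"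
      using im[OF uv(4), of "c i"] uv(5) by (auto simp: image_add_atLeastAtMost)
    \<comment> \<open>The child is again a translate; \<open>1 \<le> u\<close> makes the offset
      \<open>q + u - 1\<close> exact.\<close>
    have "X (p + c i + j) = (q + u - 1) + pattern \<sigma> (c i + 1) (c (Suc i)) j"
      if j: "j \<in> {1..c (Suc i) - c i}" for j
    proof -
      have "\<sigma> (c i + j) + 1 = u + pattern \<sigma> (c i + 1) (c (Suc i)) j"
        using pattern_block[OF inj\<sigma> uv(5), of j] j uv by (simp add: Suc_diff_Suc)
      moreover have "X (p + (c i + j)) = q + \<sigma> (c i + j)" using j uv by (intro split.prems) auto
      ultimately show ?thesis using uv by (simp add: add.assoc)
    qed
    then have "block_cost X (p + c i) (p + c i + (c (Suc i) - c i)) +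
        potential (stamp X (p + c i + (c (Suc i) - c i))) (X ` {p + c i<..p + c i + (c (Suc i) - c i)}) + 4 * k
        \<le> (2 + 4 * k) * (c (Suc i) - c i)"
      using split.IH i by blast
    then show "block_cost X (p + c i) (p + c (Suc i)) +
        potential (stamp X (p + c (Suc i))) (X ` {p + c i<..p + c (Suc i)}) + 4 * k
        \<le> (2 + 4 * k) * (p + c (Suc i) - (p + c i))"
      using uv(3) by simp
  qed (use split.hyps in auto)
  then show ?case using whole split.hyps by simp
qed

section \<open>The final estimate\<close>

text \<open>At \<open>k = 1\<close> the left side is 6, so 3 is the least integer factor possible in
  the exponent.\<close>

lemma linear_le_two_powr:
  assumes "1 \<le> k"
  shows "real (2 + 4 * k) \<le> 2 powr (3 * (real k)\<^sup>2)"
proof -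
  have "2 + 4 * k \<le> 2 ^ (3 * k)" using assms
    by (induction k rule: dec_induct) (auto simp: power_add)
  then have "real (2 + 4 * k) \<le> 2 ^ (3 * k)" by (metis of_nat_le_iff of_nat_numeral of_nat_power)
  also have "\<dots> = 2 powr (3 * real k)" by (simp add: powr_realpow[symmetric])
  also have "\<dots> \<le> 2 powr (3 * (real k)\<^sup>2)" using assms by (simp add: power2_eq_square)
  finally show ?thesis .
qed

theorem mainTheorem4:
  shows "\<exists>c::real. \<forall>(n::nat) (k::nat) (X::nat \<Rightarrow> nat).
    X permutes {1..n} \<longrightarrow> decomposable k n X \<longrightarrow>
      real (card (greedy n X)) \<le> real n * 2 powr (c * (real k)\<^sup>2)"
proof (intro exI allI impI)
  fix n k :: nat and X :: "nat \<Rightarrow> nat"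
  assume X: "X permutes {1..n}" and dec: "decomposable k n X"
  have n: "1 \<le> n" using dec by cases auto
  \<comment> \<open>The first row of the whole sequence has no ancestor to charge, so its cost is
    computed directly.\<close>
  have "visible (stamp X 0) (X (Suc 0)) = {X (Suc 0)}"
    using visible_pos[of _ "stamp X 0" "X (Suc 0)"] by auto
  then have row0: "row_cost X 0 = 1" by (simp add: row_cost_def)
  have "{..<n} = insert 0 {0<..<n}" using n by auto
  then have card: "card (greedy n X) \<le> 1 + block_cost X 0 n"
    using card_greedy_upto_le[of X n] row0 by (simp add: greedy_def block_cost_def)
  show "real (card (greedy n X)) \<le> real n * 2 powr (3 * (real k)\<^sup>2)"
  \<comment> \<open>For \<open>k = 0\<close> the linear factor would be 2 while the power is 1, but
    then only a single access is possible.\<close>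
  proof (cases "k = 0")
    case True
    with dec have "n = 1" by cases auto
    moreover have "{0<..<1::nat} = {}" by auto
    ultimately show ?thesis using card True by (simp add: block_cost_def)
  next
    case False
    have "block_cost X 0 n + 4 * k \<le> (2 + 4 * k) * n"
      using decomposable_block_cost[OF dec permutes_inj[OF X], of 0 0] by simp
    \<comment> \<open>The credit \<open>4 * k\<close>, now positive, absorbs the cost 1 of the first
      row.\<close>
    then have "card (greedy n X) \<le> n * (2 + 4 * k)" using card False by (simp add: mult.commute)
    then have "real (card (greedy n X)) \<le> real n * real (2 + 4 * k)"
      by (metis of_nat_le_iff of_nat_mult)
    also have "\<dots> \<le> real n * 2 powr (3 * (real k)\<^sup>2)"
      using linear_le_two_powr[of k] False by (intro mult_left_mono) auto
    finally show ?thesis .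
  qed
qed

end
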